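(* Let $\mathscr{C}$ be a symmetric monoidal category. There is a (strict) involutive symmetric monoidal functor $(-)^* : \mathbf{Learn}_{\mathscr{C}} \to \mathbf{Learn}_{\mathscr{C}}^{\mathrm{op}}$ given on objects by $(A, A')^* := (A', A)$ and on morphisms by $(l \mid r)^* := (r \mid l)$.
   Context: $\mathscr{C}$ has tensor $\otimes$, unit $I$ and symmetry $s$; associators and unitors of $\mathscr{C}$ are suppressed in formulas. A learner from $(A,A')$ to $(B,B')$ is an element of the coend $\int^{P, Q : \mathscr{C}} \mathscr{C}(P \otimes A, Q \otimes B) \times \mathscr{C}(Q \otimes B', P \otimes A')$. Concretely, it is an equivalence class $(f \mid g)$ of a choice of parameter objects $P, Q$ and morphisms $f : P \otimes A \to Q \otimes B$, $g : Q \otimes B' \to P \otimes A'$, under the equivalence relation generated by $((q \otimes B) \circ f \circ (p \otimes A) \mid g) \sim (f \mid (p \otimes A') \circ g \circ (q \otimes B'))$ for all $p : P \to P'$, $q : Q \to Q'$, $f : P' \otimes A \to Q \otimes B$, $g : Q' \otimes B' \to P \otimes A'$. The collection of learners between two objects is allowed to be large when $\mathscr{C}$ is not small. The category $\mathbf{Learn}_{\mathscr{C}}$ has objects the pairs $(A,A')$ of objects of $\mathscr{C}$ and morphisms the learners. The identity on $(A,A')$ is $(\mathrm{id}_{I \otimes A} \mid \mathrm{id}_{I \otimes A'})$. The composite of $(l_1 \mid r_1) : (A, A') \to (B, B')$ (parameters $P_1,Q_1$) followed by $(l_2 \mid r_2) : (B, B') \to (C, C')$ (parameters $P_2,Q_2$)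 has parameters $P_2 \otimes P_1$ and $Q_1 \otimes Q_2$ and is represented by $(Q_1 \otimes l_2)\circ(s_{P_2,Q_1} \otimes B)\circ(P_2 \otimes l_1)$ and $(P_2 \otimes r_1)\circ(s_{Q_1,P_2} \otimes B')\circ(Q_1 \otimes r_2)$. $\mathbf{Learn}_{\mathscr{C}}$ is symmetric monoidal with unit $(I,I)$, $(A, A') \otimes (B, B') := (A \otimes B, B' \otimes A')$, and, for $(l_i \mid r_i) : (A_i,A_i') \to (B_i,B_i')$ with parameters $P_i,Q_i$ ($i\in\{L,R\}$), $(l_L \mid r_L) \otimes (l_R \mid r_R)$ having parameters $P_L \otimes P_R$ and $Q_R \otimes Q_L$ and represented by $l_L \otimes l_R$ and $r_R \otimes r_L$ pre- and post-composed with the evident permutations of tensor factors, giving maps $P_L \otimes P_R \otimes A_L \otimes A_R \to Q_R \otimes Q_L \otimes B_L \otimes B_R$ and $Q_R \otimes Q_L \otimes B_R' \otimes B_L' \to P_L \otimes P_R \otimes A_R' \otimes A_L'$. There is a functor $\iota : \mathscr{C} \times \mathscr{C}^{\mathrm{op}} \to \mathbf{Learn}_{\mathscr{C}}$, the identity on objects, sending $f : A \to B$ and $g : B' \to A'$ to $(I \otimes f \mid I \otimes g) : (A,A') \to (B,B')$; the structure isomorphisms of $\mathbf{Learn}_{\mathscr{C}}$ are the images under $\iota$ of those of $\mathscr{C} \times \mathscr{C}^{\mathrm{op}}$ (with tensor reversed in the second factor). *)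

theory Defs
  imports Main
begin

section \<open>Categories and symmetric monoidal categories\<close>

record ('o, 'm) cat =
  Obj :: "'o set"
  Arr :: "'m set"
  Dom :: "'m \<Rightarrow> 'o"
  Cod :: "'m \<Rightarrow> 'o"
  ident :: "'o \<Rightarrow> 'm" ("id\<index>")
  cmp :: "'m \<Rightarrow> 'm \<Rightarrow> 'm"  (infixr "\<cdot>\<index>" 65)

text \<open>\<open>g \<cdot> f\<close> is \<open>g\<close> after \<open>f\<close>.\<close>

definition Hom :: "('o, 'm, 'x) cat_scheme \<Rightarrow> 'o \<Rightarrow> 'o \<Rightarrow> 'm set" where
  "Hom C A B = {f \<in> Arr C. Dom C f = A \<and> Cod C f = B}"

locale category =
  fixes C :: "('o, 'm, 'x) cat_scheme" (structure)
  assumes Dom_in: "f \<in> Arr C \<Longrightarrow> Dom C f \<in> Obj C"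
    and Cod_in: "f \<in> Arr C \<Longrightarrow> Cod C f \<in> Obj C"
    and ident_in: "A \<in> Obj C \<Longrightarrow> id A \<in> Hom C A A"
    and cmp_in: "f \<in> Hom C A B \<Longrightarrow> g \<in> Hom C B D \<Longrightarrow> g \<cdot> f \<in> Hom C A D"
    and ident_left: "f \<in> Hom C A B \<Longrightarrow> id B \<cdot> f = f"
    and ident_right: "f \<in> Hom C A B \<Longrightarrow> f \<cdot> id A = f"
    and cmp_assoc: "f \<in> Hom C A B \<Longrightarrow> g \<in> Hom C B D \<Longrightarrow> h \<in> Hom C D E
      \<Longrightarrow> (h \<cdot> g) \<cdot> f = h \<cdot> (g \<cdot> f)"

text \<open>The structure isomorphisms are recorded together with their inverses (the inverse of the
  symmetry at \<open>A, B\<close> is the symmetry at \<open>B, A\<close>), so that no choice is needed to form opposites.\<close>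

record ('o, 'm) smc = "('o, 'm) cat" +
  tenso :: "'o \<Rightarrow> 'o \<Rightarrow> 'o"  (infixr "\<boxtimes>\<index>" 75)
  tensa :: "'m \<Rightarrow> 'm \<Rightarrow> 'm"  (infixr "\<otimes>\<index>" 75)
  unit_obj :: "'o"  ("I\<index>")
  assoc :: "'o \<Rightarrow> 'o \<Rightarrow> 'o \<Rightarrow> 'm"  ("\<alpha>\<index>")
  assoc_inv :: "'o \<Rightarrow> 'o \<Rightarrow> 'o \<Rightarrow> 'm"  ("\<alpha>''\<index>")
  lunit :: "'o \<Rightarrow> 'm"  ("\<lambda>l\<index>")
  lunit_inv :: "'o \<Rightarrow> 'm"  ("\<lambda>l''\<index>")
  runit :: "'o \<Rightarrow> 'm"  ("\<rho>\<index>")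
  runit_inv :: "'o \<Rightarrow> 'm"  ("\<rho>''\<index>")
  symm :: "'o \<Rightarrow> 'o \<Rightarrow> 'm"  ("\<sigma>\<index>")

definition inverse_arrows :: "('o, 'm, 'x) cat_scheme \<Rightarrow> 'o \<Rightarrow> 'o \<Rightarrow> 'm \<Rightarrow> 'm \<Rightarrow> bool" where
  "inverse_arrows C A B f g \<longleftrightarrow> f \<in> Hom C A B \<and> g \<in> Hom C B A
     \<and> cmp C g f = ident C A \<and> cmp C f g = ident C B"

locale symmetric_monoidal_category = category C
  for C :: "('o, 'm) smc" (structure) +
  assumes tenso_in: "A \<in> Obj C \<Longrightarrow> B \<in> Obj C \<Longrightarrow> A \<boxtimes> B \<in> Obj C"
    and tensa_in: "f \<in> Hom C A B \<Longrightarrow> g \<in> Hom C D E \<Longrightarrow> f \<otimes> g \<in> Hom C (A \<boxtimes> D) (B \<boxtimes> E)"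
    and tensa_ident: "A \<in> Obj C \<Longrightarrow> B \<in> Obj C \<Longrightarrow> id A \<otimes> id B = id (A \<boxtimes> B)"
    and tensa_cmp: "f \<in> Hom C A B \<Longrightarrow> f' \<in> Hom C B D \<Longrightarrow> g \<in> Hom C A' B' \<Longrightarrow> g' \<in> Hom C B' D'
      \<Longrightarrow> (f' \<cdot> f) \<otimes> (g' \<cdot> g) = (f' \<otimes> g') \<cdot> (f \<otimes> g)"
    and unit_in: "I \<in> Obj C"
    and assoc_iso: "A \<in> Obj C \<Longrightarrow> B \<in> Obj C \<Longrightarrow> D \<in> Obj C \<Longrightarrow>
      inverse_arrows C ((A \<boxtimes> B) \<boxtimes> D) (A \<boxtimes> (B \<boxtimes> D)) (\<alpha> A B D) (\<alpha>' A B D)"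
    and assoc_natural: "f \<in> Hom C A A' \<Longrightarrow> g \<in> Hom C B B' \<Longrightarrow> h \<in> Hom C D D' \<Longrightarrow>
      \<alpha> A' B' D' \<cdot> ((f \<otimes> g) \<otimes> h) = (f \<otimes> (g \<otimes> h)) \<cdot> \<alpha> A B D"
    and lunit_iso: "A \<in> Obj C \<Longrightarrow> inverse_arrows C (I \<boxtimes> A) A (\<lambda>l A) (\<lambda>l' A)"
    and lunit_natural: "f \<in> Hom C A B \<Longrightarrow> \<lambda>l B \<cdot> (id I \<otimes> f) = f \<cdot> \<lambda>l A"
    and runit_iso: "A \<in> Obj C \<Longrightarrow> inverse_arrows C (A \<boxtimes> I) A (\<rho> A) (\<rho>' A)"
    and runit_natural: "f \<in> Hom C A B \<Longrightarrow> \<rho> B \<cdot> (f \<otimes> id I) = f \<cdot> \<rho> A"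
    and symm_iso: "A \<in> Obj C \<Longrightarrow> B \<in> Obj C \<Longrightarrow>
      inverse_arrows C (A \<boxtimes> B) (B \<boxtimes> A) (\<sigma> A B) (\<sigma> B A)"
    and symm_natural: "f \<in> Hom C A A' \<Longrightarrow> g \<in> Hom C B B' \<Longrightarrow>
      \<sigma> A' B' \<cdot> (f \<otimes> g) = (g \<otimes> f) \<cdot> \<sigma> A B"
    and pentagon: "A \<in> Obj C \<Longrightarrow> B \<in> Obj C \<Longrightarrow> D \<in> Obj C \<Longrightarrow> E \<in> Obj C \<Longrightarrow>
      (id A \<otimes> \<alpha> B D E) \<cdot> \<alpha> A (B \<boxtimes> D) E \<cdot> (\<alpha> A B D \<otimes> id E)
        = \<alpha> A B (D \<boxtimes> E) \<cdot> \<alpha> (A \<boxtimes> B) D E"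
    and triangle: "A \<in> Obj C \<Longrightarrow> B \<in> Obj C \<Longrightarrow>
      (id A \<otimes> \<lambda>l B) \<cdot> \<alpha> A I B = \<rho> A \<otimes> id B"
    and hexagon: "A \<in> Obj C \<Longrightarrow> B \<in> Obj C \<Longrightarrow> D \<in> Obj C \<Longrightarrow>
      \<alpha> B D A \<cdot> \<sigma> A (B \<boxtimes> D) \<cdot> \<alpha> A B D
        = (id B \<otimes> \<sigma> A D) \<cdot> \<alpha> B A D \<cdot> (\<sigma> A B \<otimes> id D)"

section \<open>Opposites and strict symmetric monoidal functors\<close>

definition op_smc :: "('o, 'm) smc \<Rightarrow> ('o, 'm) smc" where
  "op_smc C = \<lparr>
     Obj = Obj C, Arr = Arr C, Dom = Cod C, Cod = Dom C,
     ident = ident C, cmp = (\<lambda>g f. cmp C f g),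
     tenso = tenso C, tensa = tensa C, unit_obj = unit_obj C,
     assoc = assoc_inv C, assoc_inv = assoc C,
     lunit = lunit_inv C, lunit_inv = lunit C,
     runit = runit_inv C, runit_inv = runit C,
     symm = (\<lambda>A B. symm C B A) \<rparr>"

definition rev_smc :: "('o, 'm) smc \<Rightarrow> ('o, 'm) smc" where
  "rev_smc C = \<lparr>
     Obj = Obj C, Arr = Arr C, Dom = Dom C, Cod = Cod C,
     ident = ident C, cmp = cmp C,
     tenso = (\<lambda>A B. tenso C B A), tensa = (\<lambda>f g. tensa C g f), unit_obj = unit_obj C,
     assoc = (\<lambda>A B D. assoc_inv C D B A), assoc_inv = (\<lambda>A B D. assoc C D B A),
     lunit = runit C, lunit_inv = runit_inv C,
     runit = lunit C, runit_inv = lunit_inv C,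
     symm = (\<lambda>A B. symm C B A) \<rparr>"

text \<open>The monoidal opposite relevant to duals reverses both the arrows and the order of the
  tensor: since \<open>((A, A') \<otimes> (B, B'))* = (B' \<otimes> A', A \<otimes> B) = (B, B')* \<otimes> (A, A')*\<close>, the dual is
  \<^emph>\<open>strictly\<close> monoidal exactly for this opposite.\<close>

definition dual_smc :: "('o, 'm) smc \<Rightarrow> ('o, 'm) smc" where
  "dual_smc C = rev_smc (op_smc C)"

text \<open>A functor between (symmetric monoidal) categories is given by its object map \<open>F\<close> and its
  arrow map \<open>\<Phi>\<close>; strictness means that tensor, unit and structure isomorphisms are preserved
  on the nose.\<close>

definition is_functor ::
  "('o, 'm, 'x) cat_scheme \<Rightarrow> ('p, 'n, 'y) cat_scheme \<Rightarrow> ('o \<Rightarrow> 'p) \<Rightarrow> ('m \<Rightarrow> 'n) \<Rightarrow> bool" where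
  "is_functor C D F \<Phi> \<longleftrightarrow>
     (\<forall>A \<in> Obj C. F A \<in> Obj D) \<and>
     (\<forall>A \<in> Obj C. \<forall>B \<in> Obj C. \<forall>f \<in> Hom C A B. \<Phi> f \<in> Hom D (F A) (F B)) \<and>
     (\<forall>A \<in> Obj C. \<Phi> (ident C A) = ident D (F A)) \<and>
     (\<forall>f \<in> Arr C. \<forall>g \<in> Arr C. Cod C f = Dom C g \<longrightarrow> \<Phi> (cmp C g f) = cmp D (\<Phi> g) (\<Phi> f))"

definition is_strict_symmetric_monoidal_functor ::
  "('o, 'm) smc \<Rightarrow> ('p, 'n) smc \<Rightarrow> ('o \<Rightarrow> 'p) \<Rightarrow> ('m \<Rightarrow> 'n) \<Rightarrow> bool" where
  "is_strict_symmetric_monoidal_functor C D F \<Phi> \<longleftrightarrow>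
     is_functor C D F \<Phi> \<and>
     F (unit_obj C) = unit_obj D \<and>
     (\<forall>A \<in> Obj C. \<forall>B \<in> Obj C. F (tenso C A B) = tenso D (F A) (F B)) \<and>
     (\<forall>f \<in> Arr C. \<forall>g \<in> Arr C. \<Phi> (tensa C f g) = tensa D (\<Phi> f) (\<Phi> g)) \<and>
     (\<forall>A \<in> Obj C. \<forall>B \<in> Obj C. \<forall>E \<in> Obj C.
        \<Phi> (assoc C A B E) = assoc D (F A) (F B) (F E)) \<and>
     (\<forall>A \<in> Obj C. \<Phi> (lunit C A) = lunit D (F A)) \<and>
     (\<forall>A \<in> Obj C. \<Phi> (runit C A) = runit D (F A)) \<and>
     (\<forall>A \<in> Obj C. \<forall>B \<in> Obj C. \<Phi> (symm C A B) = symm D (F A) (F B))"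

text \<open>A functor from \<open>C\<close> to an opposite of \<open>C\<close> is involutive if its composite with its own
  opposite (which has the same object and arrow maps) is the identity functor.\<close>

definition is_involutive :: "('o, 'm, 'x) cat_scheme \<Rightarrow> ('o \<Rightarrow> 'o) \<Rightarrow> ('m \<Rightarrow> 'm) \<Rightarrow> bool" where
  "is_involutive C F \<Phi> \<longleftrightarrow> (\<forall>A \<in> Obj C. F (F A) = A) \<and> (\<forall>f \<in> Arr C. \<Phi> (\<Phi> f) = f)"

section \<open>Learners\<close>

text \<open>A representative \<open>(P, Q, f, g)\<close> of a learner consists of two parameter objects and two
  arrows. A learner is an equivalence class of representatives, tagged with its domain and
  codomain (which the arrows \<open>f\<close> and \<open>g\<close> alone do not determine).\<close>

type_synonym ('o, 'm) rep = "'o \<times> 'o \<times> 'm \<times> 'm"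
type_synonym ('o, 'm) learner = "('o \<times> 'o) \<times> ('o \<times> 'o) \<times> ('o, 'm) rep set"

context
  fixes C :: "('o, 'm) smc" (structure)
begin

fun reps :: "'o \<times> 'o \<Rightarrow> 'o \<times> 'o \<Rightarrow> ('o, 'm) rep set" where
  "reps (A, A') (B, B') = {(P, Q, f, g). P \<in> Obj C \<and> Q \<in> Obj C \<and>
     f \<in> Hom C (P \<boxtimes> A) (Q \<boxtimes> B) \<and> g \<in> Hom C (Q \<boxtimes> B') (P \<boxtimes> A')}"

inductive rep_equiv :: "'o \<times> 'o \<Rightarrow> 'o \<times> 'o \<Rightarrow> ('o, 'm) rep \<Rightarrow> ('o, 'm) rep \<Rightarrow> bool"
  for X Y :: "'o \<times> 'o" where
  slide: "\<lbrakk> X = (A, A'); Y = (B, B');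
      A \<in> Obj C; A' \<in> Obj C; B \<in> Obj C; B' \<in> Obj C;
      P \<in> Obj C; P' \<in> Obj C; Q \<in> Obj C; Q' \<in> Obj C;
      p \<in> Hom C P P'; q \<in> Hom C Q Q';
      f \<in> Hom C (P' \<boxtimes> A) (Q \<boxtimes> B); g \<in> Hom C (Q' \<boxtimes> B') (P \<boxtimes> A') \<rbrakk>
    \<Longrightarrow> rep_equiv X Y (P, Q', (q \<otimes> id B) \<cdot> f \<cdot> (p \<otimes> id A), g)
                      (P', Q, f, (p \<otimes> id A') \<cdot> g \<cdot> (q \<otimes> id B'))"
| refl: "t \<in> reps X Y \<Longrightarrow> rep_equiv X Y t t"
| sym: "rep_equiv X Y t u \<Longrightarrow> rep_equiv X Y u t"
| trans: "rep_equiv X Y t u \<Longrightarrow> rep_equiv X Y u v \<Longrightarrow> rep_equiv X Y t v"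

definition rep_class :: "'o \<times> 'o \<Rightarrow> 'o \<times> 'o \<Rightarrow> ('o, 'm) rep \<Rightarrow> ('o, 'm) rep set" where
  "rep_class X Y t = {u. rep_equiv X Y t u}"

text \<open>The learner \<open>(f | g) : X \<rightarrow> Y\<close> with parameters \<open>P\<close> and \<open>Q\<close>.\<close>

definition mk_learner :: "'o \<times> 'o \<Rightarrow> 'o \<times> 'o \<Rightarrow> 'o \<Rightarrow> 'o \<Rightarrow> 'm \<Rightarrow> 'm \<Rightarrow> ('o, 'm) learner" where
  "mk_learner X Y P Q f g = (X, Y, rep_class X Y (P, Q, f, g))"

subsection \<open>Operations on representatives\<close>

text \<open>\<open>(Q1 \<otimes> l2) \<circ> (s \<otimes> B) \<circ> (P2 \<otimes> l1) : (P2 \<otimes> P1) \<otimes> A \<rightarrow> (Q1 \<otimes> Q2) \<otimes> D\<close> with its associators, for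
  \<open>l1 : P1 \<otimes> A \<rightarrow> Q1 \<otimes> B\<close> and \<open>l2 : P2 \<otimes> B \<rightarrow> Q2 \<otimes> D\<close>. The same formula, with the
  roles of the two learners exchanged, gives the backward component of a composite.\<close>

definition seq_half :: "'o \<Rightarrow> 'o \<Rightarrow> 'o \<Rightarrow> 'o \<Rightarrow> 'o \<Rightarrow> 'o \<Rightarrow> 'o \<Rightarrow> 'm \<Rightarrow> 'm \<Rightarrow> 'm" where
  "seq_half P1 Q1 P2 Q2 A B D l1 l2 =
     \<alpha>' Q1 Q2 D \<cdot> (id Q1 \<otimes> l2) \<cdot> \<alpha> Q1 P2 B \<cdot> (\<sigma> P2 Q1 \<otimes> id B)
       \<cdot> \<alpha>' P2 Q1 B \<cdot> (id P2 \<otimes> l1) \<cdot> \<alpha> P2 P1 A"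

fun seq_rep :: "'o \<times> 'o \<Rightarrow> 'o \<times> 'o \<Rightarrow> 'o \<times> 'o \<Rightarrow>
    ('o, 'm) rep \<Rightarrow> ('o, 'm) rep \<Rightarrow> ('o, 'm) rep" where
  "seq_rep (A, A') (B, B') (D, D') (P1, Q1, l1, r1) (P2, Q2, l2, r2) =
     (P2 \<boxtimes> P1, Q1 \<boxtimes> Q2,
      seq_half P1 Q1 P2 Q2 A B D l1 l2,
      seq_half Q2 P2 Q1 P1 D' B' A' r2 r1)"

text \<open>The middle interchange \<open>(W \<otimes> X) \<otimes> (Y \<otimes> Z) \<rightarrow> (W \<otimes> Y) \<otimes> (X \<otimes> Z)\<close>.\<close>

definition interchange :: "'o \<Rightarrow> 'o \<Rightarrow> 'o \<Rightarrow> 'o \<Rightarrow> 'm" where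
  "interchange W X Y Z =
     \<alpha>' W Y (X \<boxtimes> Z) \<cdot> (id W \<otimes> (\<alpha> Y X Z \<cdot> (\<sigma> X Y \<otimes> id Z) \<cdot> \<alpha>' X Y Z)) \<cdot> \<alpha> W X (Y \<boxtimes> Z)"

text \<open>For \<open>l1 : P1 \<otimes> A1 \<rightarrow> Q1 \<otimes> B1\<close> and \<open>l2 : P2 \<otimes> A2 \<rightarrow> Q2 \<otimes> B2\<close>, the arrow \<open>l1 \<otimes> l2\<close> rearranged
  to \<open>(P1 \<otimes> P2) \<otimes> (A1 \<otimes> A2) \<rightarrow> (Q2 \<otimes> Q1) \<otimes> (B1 \<otimes> B2)\<close>.\<close>

definition tens_half ::
    "'o \<Rightarrow> 'o \<Rightarrow> 'o \<Rightarrow> 'o \<Rightarrow> 'o \<Rightarrow> 'o \<Rightarrow> 'o \<Rightarrow> 'o \<Rightarrow> 'm \<Rightarrow> 'm \<Rightarrow> 'm" where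
  "tens_half P1 Q1 P2 Q2 A1 B1 A2 B2 l1 l2 =
     (\<sigma> Q1 Q2 \<otimes> id (B1 \<boxtimes> B2)) \<cdot> interchange Q1 B1 Q2 B2 \<cdot> (l1 \<otimes> l2) \<cdot> interchange P1 P2 A1 A2"

fun tens_rep :: "'o \<times> 'o \<Rightarrow> 'o \<times> 'o \<Rightarrow> 'o \<times> 'o \<Rightarrow> 'o \<times> 'o \<Rightarrow>
    ('o, 'm) rep \<Rightarrow> ('o, 'm) rep \<Rightarrow> ('o, 'm) rep" where
  "tens_rep (A1, A1') (B1, B1') (A2, A2') (B2, B2') (P1, Q1, l1, r1) (P2, Q2, l2, r2) =
     (P1 \<boxtimes> P2, Q2 \<boxtimes> Q1,
      tens_half P1 Q1 P2 Q2 A1 B1 A2 B2 l1 l2,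
      tens_half Q2 P2 Q1 P1 B2' A2' B1' A1' r2 r1)"

subsection \<open>The symmetric monoidal category of learners\<close>

fun pair_tens :: "'o \<times> 'o \<Rightarrow> 'o \<times> 'o \<Rightarrow> 'o \<times> 'o" where
  "pair_tens (A, A') (B, B') = (A \<boxtimes> B, B' \<boxtimes> A')"

definition learners :: "('o, 'm) learner set" where
  "learners = {mk_learner X Y P Q f g | X Y P Q f g.
     X \<in> Obj C \<times> Obj C \<and> Y \<in> Obj C \<times> Obj C \<and> (P, Q, f, g) \<in> reps X Y}"

text \<open>Operations on classes take all representatives at once; the union of the resulting
  classes is a single class because the operations respect the equivalence.\<close>

fun seq_learner :: "('o, 'm) learner \<Rightarrow> ('o, 'm) learner \<Rightarrow> ('o, 'm) learner" where
  "seq_learner (X, Y, T) (Y', Z, U) =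
     (X, Z, \<Union>t \<in> T. \<Union>u \<in> U. rep_class X Z (seq_rep X Y Z t u))"

fun tens_learner :: "('o, 'm) learner \<Rightarrow> ('o, 'm) learner \<Rightarrow> ('o, 'm) learner" where
  "tens_learner (X1, Y1, T) (X2, Y2, U) =
     (pair_tens X1 X2, pair_tens Y1 Y2,
      \<Union>t \<in> T. \<Union>u \<in> U. rep_class (pair_tens X1 X2) (pair_tens Y1 Y2) (tens_rep X1 Y1 X2 Y2 t u))"

text \<open>The functor \<open>\<iota>\<close> on \<open>f : A \<rightarrow> B\<close> and \<open>g : B' \<rightarrow> A'\<close>.\<close>

definition iota :: "'m \<Rightarrow> 'm \<Rightarrow> ('o, 'm) learner" where
  "iota f g = mk_learner (Dom C f, Cod C g) (Cod C f, Dom C g) I I (id I \<otimes> f) (id I \<otimes> g)"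

definition Learn :: "('o \<times> 'o, ('o, 'm) learner) smc" where
  "Learn = \<lparr>
     Obj = Obj C \<times> Obj C,
     Arr = learners,
     Dom = (\<lambda>(X, Y, T). X),
     Cod = (\<lambda>(X, Y, T). Y),
     ident = (\<lambda>(A, A'). mk_learner (A, A') (A, A') I I (id (I \<boxtimes> A)) (id (I \<boxtimes> A'))),
     cmp = (\<lambda>g f. seq_learner f g),
     tenso = pair_tens,
     tensa = tens_learner,
     unit_obj = (I, I),
     assoc = (\<lambda>(A, A') (B, B') (D, D'). iota (\<alpha> A B D) (\<alpha> D' B' A')),
     assoc_inv = (\<lambda>(A, A') (B, B') (D, D'). iota (\<alpha>' A B D) (\<alpha>' D' B' A')),
     lunit = (\<lambda>(A, A'). iota (\<lambda>l A) (\<rho>' A')),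
     lunit_inv = (\<lambda>(A, A'). iota (\<lambda>l' A) (\<rho> A')),
     runit = (\<lambda>(A, A'). iota (\<rho> A) (\<lambda>l' A')),
     runit_inv = (\<lambda>(A, A'). iota (\<rho>' A) (\<lambda>l A')),
     symm = (\<lambda>(A, A') (B, B'). iota (\<sigma> A B) (\<sigma> A' B')) \<rparr>"

end

end

theory Submission
  imports Defs
begin

text \<open>A learner \<open>(A, A') \<rightarrow> (B, B')\<close> is a pair of arrows \<open>l : P \<otimes> A \<rightarrow> Q \<otimes> B\<close> and
  \<open>r : Q \<otimes> B' \<rightarrow> P \<otimes> A'\<close>, and this shape is symmetric: exchanging \<open>l\<close> with \<open>r\<close> and \<open>P\<close> with
  \<open>Q\<close> gives the data of a learner \<open>(B', B) \<rightarrow> (A', A)\<close>. The dual is this exchange.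

  It is well defined because a parameter arrow slides between \<open>l\<close> and \<open>r\<close> in both directions:
  the exchange turns a generating relation into a generating relation read backwards, with the
  roles of \<open>p\<close> and \<open>q\<close> interchanged (\<open>rep_equiv_swap_rep\<close>). It is strictly functorial and
  monoidal because the backward half of a composite, or of a tensor, is the same formula as the
  forward half, applied to the backward arrows in the opposite order. The two operations thus
  commute with the exchange already on representatives, as equalities of arrows of \<open>C\<close>
  (\<open>seq_rep_swap_rep\<close>, \<open>tens_rep_swap_rep\<close>). Finally, the structure isomorphisms are values
  of \<open>\<iota>\<close>, and the dual sends \<open>\<iota> f g\<close> to \<open>\<iota> g f\<close> (\<open>dual_learner_iota\<close>).\<close>

fun swap_rep :: "('o, 'm) rep \<Rightarrow> ('o, 'm) rep" where
  "swap_rep (P, Q, f, g) = (Q, P, g, f)"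

lemma swap_rep_swap_rep [simp]: "swap_rep (swap_rep t) = t"
  by (cases t) simp

text \<open>The dual acts on the whole class by direct image, so that it needs no choice of a
  representative and commutes with the unions by which composites and tensors are formed.\<close>

fun dual_learner :: "('o, 'm) learner \<Rightarrow> ('o, 'm) learner" where
  "dual_learner (X, Y, T) = (prod.swap Y, prod.swap X, swap_rep ` T)"

lemma dual_learner_dual_learner [simp]: "dual_learner (dual_learner L) = L"
  by (cases L) (simp add: image_comp comp_def)

lemma swap_rep_in_reps:
  assumes "t \<in> reps C X Y"
  shows "swap_rep t \<in> reps C (prod.swap Y) (prod.swap X)"
  using assms by (cases X; cases Y; cases t) auto

text \<open>The exchange carries the generator for \<open>p\<close>, \<open>q\<close>, \<open>f\<close>, \<open>g\<close> to the converse of the generator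
  for \<open>q\<close>, \<open>p\<close>, \<open>g\<close>, \<open>f\<close>.\<close>

lemma rep_equiv_swap_rep:
  assumes "rep_equiv C X Y t u"
  shows "rep_equiv C (prod.swap Y) (prod.swap X) (swap_rep t) (swap_rep u)"
  using assms
proof (induction rule: rep_equiv.induct)
  case (slide A A' B B' P P' Q Q' p q f g)
  have "rep_equiv C (B', B) (A', A)
      (Q, P', cmp C (tensa C p (ident C A')) (cmp C g (tensa C q (ident C B'))), f)
      (Q', P, g, cmp C (tensa C q (ident C B)) (cmp C f (tensa C p (ident C A))))"
    using slide by (intro rep_equiv.slide) auto
  from rep_equiv.sym[OF this] show ?case
    using slide by simp
next
  case (refl t)
  then show ?case
    by (intro rep_equiv.refl swap_rep_in_reps)
next
  case (sym t u)
  show ?case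
    using sym.IH by (rule rep_equiv.sym)
next
  case (trans t u v)
  show ?case
    using trans.IH by (rule rep_equiv.trans)
qed

lemma swap_rep_image_rep_class:
  "swap_rep ` rep_class C X Y t = rep_class C (prod.swap Y) (prod.swap X) (swap_rep t)"
proof
  show "swap_rep ` rep_class C X Y t \<subseteq> rep_class C (prod.swap Y) (prod.swap X) (swap_rep t)"
    by (auto simp: rep_class_def dest: rep_equiv_swap_rep)
  show "rep_class C (prod.swap Y) (prod.swap X) (swap_rep t) \<subseteq> swap_rep ` rep_class C X Y t"
  proof
    fix u
    assume "u \<in> rep_class C (prod.swap Y) (prod.swap X) (swap_rep t)"
    then have "swap_rep u \<in> rep_class C X Y t"
      using rep_equiv_swap_rep[of C "prod.swap Y" "prod.swap X" "swap_rep t" u]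
      by (simp add: rep_class_def)
    then show "u \<in> swap_rep ` rep_class C X Y t"
      by (intro image_eqI[of u swap_rep "swap_rep u"]) simp_all
  qed
qed

lemma dual_learner_mk_learner:
  "dual_learner (mk_learner C X Y P Q f g) = mk_learner C (prod.swap Y) (prod.swap X) Q P g f"
  by (simp add: mk_learner_def swap_rep_image_rep_class)

lemma dual_learner_iota: "dual_learner (iota C f g) = iota C g f"
  by (simp add: iota_def dual_learner_mk_learner)

lemma dual_learner_in_learners:
  assumes "L \<in> learners C"
  shows "dual_learner L \<in> learners C"
proof -
  obtain X Y P Q f g where L: "L = mk_learner C X Y P Q f g"
    and X: "X \<in> Obj C \<times> Obj C" and Y: "Y \<in> Obj C \<times> Obj C"
    and rep: "(P, Q, f, g) \<in> reps C X Y"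
    using assms unfolding learners_def by auto
  have "dual_learner L = mk_learner C (prod.swap Y) (prod.swap X) Q P g f"
    by (simp add: L dual_learner_mk_learner)
  moreover have "(Q, P, g, f) \<in> reps C (prod.swap Y) (prod.swap X)"
    using swap_rep_in_reps[OF rep] by simp
  moreover have "prod.swap X \<in> Obj C \<times> Obj C" "prod.swap Y \<in> Obj C \<times> Obj C"
    using X Y by auto
  ultimately show ?thesis
    unfolding learners_def by (intro CollectI exI conjI) assumption+
qed

text \<open>The parameters of a composite are \<open>P\<^sub>2 \<otimes> P\<^sub>1\<close> and \<open>Q\<^sub>1 \<otimes> Q\<^sub>2\<close>, in opposite orders; this is
  what makes the equation hold on the nose rather than up to a symmetry.\<close>

lemma seq_rep_swap_rep:
  "swap_rep (seq_rep C X Y Z t u) =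
    seq_rep C (prod.swap Z) (prod.swap Y) (prod.swap X) (swap_rep u) (swap_rep t)"
  by (cases X; cases Y; cases Z; cases t; cases u) simp

lemma tens_rep_swap_rep:
  "swap_rep (tens_rep C X1 Y1 X2 Y2 t u) =
    tens_rep C (prod.swap Y2) (prod.swap X2) (prod.swap Y1) (prod.swap X1)
      (swap_rep u) (swap_rep t)"
  by (cases X1; cases Y1; cases X2; cases Y2; cases t; cases u) simp

lemma swap_pair_tens:
  "prod.swap (pair_tens C X Y) = pair_tens C (prod.swap Y) (prod.swap X)"
  by (cases X; cases Y) simp

text \<open>The middle object of a composite is read off from the codomain of the first learner. Its
  dual reads it off from the codomain of the dual of the second, that is, from the domain of the
  second, so the two learners must be composable.\<close>

lemma dual_learner_seq_learner:
  assumes "Cod (Learn C) L = Dom (Learn C) M"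
  shows "dual_learner (seq_learner C L M) = seq_learner C (dual_learner M) (dual_learner L)"
proof -
  obtain X Y T where L: "L = (X, Y, T)"
    by (cases L)
  obtain Z U where M: "M = (Y, Z, U)"
    using assms by (cases M) (simp add: L Learn_def)
  show ?thesis
    by (simp add: L M image_UN swap_rep_image_rep_class seq_rep_swap_rep)
      (rule SUP_commute)
qed

lemma dual_learner_tens_learner:
  "dual_learner (tens_learner C L M) = tens_learner C (dual_learner M) (dual_learner L)"
proof -
  obtain X1 Y1 T where L: "L = (X1, Y1, T)"
    by (cases L)
  obtain X2 Y2 U where M: "M = (X2, Y2, U)"
    by (cases M)
  show ?thesis
    by (simp add: L M image_UN swap_rep_image_rep_class tens_rep_swap_rep swap_pair_tens)
      (rule SUP_commute)
qed

lemma dual_learner_functor: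
  "is_functor (Learn C) (dual_smc (Learn C)) prod.swap dual_learner"
  unfolding is_functor_def
proof (intro conjI ballI impI)
  fix L M
  assume "Cod (Learn C) L = Dom (Learn C) M"
  from dual_learner_seq_learner[OF this]
  show "dual_learner (cmp (Learn C) M L) =
      cmp (dual_smc (Learn C)) (dual_learner M) (dual_learner L)"
    by (simp add: Learn_def dual_smc_def rev_smc_def op_smc_def)
next
  fix X Y L
  assume "L \<in> Hom (Learn C) X Y"
  then show "dual_learner L \<in> Hom (dual_smc (Learn C)) (prod.swap X) (prod.swap Y)"
    by (cases L)
      (auto simp: Hom_def Learn_def dual_smc_def rev_smc_def op_smc_def
        dest: dual_learner_in_learners)
qed (auto simp: Learn_def dual_smc_def rev_smc_def op_smc_def dual_learner_mk_learner)

text \<open>Both sides of each equation between structure isomorphisms are values of \<open>\<iota>\<close>. The opposite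
  of the arrows inverts them and the reversal of the tensor exchanges the left with the right
  unitor, which matches the exchange of the two components made by the dual.\<close>

lemma dual_learner_strict_symmetric_monoidal:
  "is_strict_symmetric_monoidal_functor (Learn C) (dual_smc (Learn C)) prod.swap dual_learner"
  unfolding is_strict_symmetric_monoidal_functor_def
proof (intro conjI ballI)
  fix L M
  show "dual_learner (tensa (Learn C) L M) =
      tensa (dual_smc (Learn C)) (dual_learner L) (dual_learner M)"
    by (simp add: Learn_def dual_smc_def rev_smc_def op_smc_def dual_learner_tens_learner)
next
  fix X Y
  show "prod.swap (tenso (Learn C) X Y) =
      tenso (dual_smc (Learn C)) (prod.swap X) (prod.swap Y)"
    by (simp add: Learn_def dual_smc_def rev_smc_def op_smc_def swap_pair_tens)
qed (rule dual_learner_functor,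
    auto simp: Learn_def dual_smc_def rev_smc_def op_smc_def dual_learner_iota)

theorem proposition2p1:
  fixes C :: "('o, 'm) smc"
  assumes "symmetric_monoidal_category C"
  shows "\<exists>star_obj star_arr.
    is_strict_symmetric_monoidal_functor (Learn C) (dual_smc (Learn C)) star_obj star_arr \<and>
    is_involutive (Learn C) star_obj star_arr \<and>
    (\<forall>A \<in> Obj C. \<forall>A' \<in> Obj C. star_obj (A, A') = (A', A)) \<and>
    (\<forall>A \<in> Obj C. \<forall>A' \<in> Obj C. \<forall>B \<in> Obj C. \<forall>B' \<in> Obj C. \<forall>P Q l r.
       (P, Q, l, r) \<in> reps C (A, A') (B, B') \<longrightarrow>
       star_arr (mk_learner C (A, A') (B, B') P Q l r) = mk_learner C (B', B) (A', A) Q P r l)"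
  using dual_learner_strict_symmetric_monoidal[of C]
  by (intro exI[of _ prod.swap] exI[of _ dual_learner])
    (simp add: is_involutive_def dual_learner_mk_learner)

end
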